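(* Suppose the initial speed is $v_0=0$. Let $\ell\ge0$, $v\ge0$, $t\ge0$, $\mathbf h\in\mathbb R^n$, and suppose $\rho_{\mathcal R_{\boldsymbol r}}(t,\mathbf h)>\ell$. Then the best universal lower estimator $T_{\rho_{\mathcal R_{\boldsymbol r}}}$ satisfies $$T_{\rho_{\mathcal R_{\boldsymbol r}}}(t,\mathbf h)=t+\frac{\lVert\mathbf h\rVert+1-\ell-t}{1+v}+W_0\left(-\frac{e^{-\frac{1+vt-\ell+\lVert\mathbf h\rVert}{1+v}}}{1+v}\right),$$ where $W_0$ is the principal branch of the Lambert function.
   Context: Let $n\in\mathbb N$, $n\ge1$; $\lVert\cdot\rVert$ is the Euclidean norm. The set of admissible controls $\mathcal A$ consists of measurable functions $\boldsymbol u$ of time $t\ge0$ with values in the closed unit ball of $\mathbb R^n$. For $\boldsymbol u\in\mathcal A$, $\boldsymbol r(\cdot;\boldsymbol u)$ and $\boldsymbol v(\cdot;\boldsymbol u)$ are the absolutely continuous solutions of $\dot{\boldsymbol r}=\boldsymbol v$, $\dot{\boldsymbol v}=\boldsymbol u-\boldsymbol v$ (a.e.) with $\boldsymbol r(0;\boldsymbol u)=\boldsymbol 0$, $\boldsymbol v(0;\boldsymbol u)=(v_0,0,\dots,0)$. Put $\mathcal R_{\boldsymbol r}(t)=\{\boldsymbol r(t;\boldsymbol u):\boldsymbol u\in\mathcal A\}$ and $\rho_{\mathcal R_{\boldsymbol r}}(t,\mathbf h)=\min_{\tilde{\mathbf h}\in\mathcal R_{\boldsymbol r}(t)}\lVert\mathbf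 h-\tilde{\mathbf h}\rVert$. For capture radius $\ell\ge0$ and target Lipschitz constant $v\ge0$, the best universal lower estimator is $$T_{\rho}(t,\mathbf h)=\min\{\theta\in[0,\infty):\theta\ge t,\ \rho(\theta,\mathbf h)=v(\theta-t)+\ell\},$$ used here with $\rho=\rho_{\mathcal R_{\boldsymbol r}}$. $W_0:[-1/e,\infty)\to[-1,\infty)$ is the inverse of $w\mapsto we^w$ on $[-1,\infty)$. *)

theory Defs
  imports "HOL-Analysis.Analysis"
begin

definition abs_continuous_on :: "real \<Rightarrow> real \<Rightarrow> (real \<Rightarrow> 'a::real_normed_vector) \<Rightarrow> bool" where
  "abs_continuous_on a b f \<longleftrightarrow>
     (\<forall>\<epsilon>>0. \<exists>\<delta>>0. \<forall>D. finite D \<and> (\<forall>(x, y)\<in>D. a \<le> x \<and> x \<le> y \<and> y \<le> b) \<and>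
        disjoint_family_on (\<lambda>(x, y). {x<..<y}) D \<and> (\<Sum>(x, y)\<in>D. y - x) < \<delta>
        \<longrightarrow> (\<Sum>(x, y)\<in>D. norm (f y - f x)) < \<epsilon>)"

definition admissible :: "(real \<Rightarrow> real ^ 'n) set" where
  "admissible = {u. u \<in> borel_measurable (lebesgue_on {0..}) \<and> (\<forall>t\<ge>0. norm (u t) \<le> 1)}"

text \<open>
  The initial velocity is \<open>(v\<^sub>0, 0, \<dots>, 0)\<close>. A finite index type carries no order, so the
  coordinate playing the role of the first one is the parameter \<open>k\<close>. Absolute continuity on the
  half-line is meant locally, on every compact interval.
\<close>
definition trajectory ::
  "'n \<Rightarrow> real \<Rightarrow> (real \<Rightarrow> real ^ 'n) \<Rightarrow> (real \<Rightarrow> real ^ 'n) \<Rightarrow> (real \<Rightarrow> real ^ 'n) \<Rightarrow> bool" where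
  "trajectory k v0 u pos vel \<longleftrightarrow>
     (\<forall>T\<ge>0. abs_continuous_on 0 T pos \<and> abs_continuous_on 0 T vel) \<and>
     (AE t in lebesgue_on {0..}. (pos has_vector_derivative vel t) (at t within {0..})) \<and>
     (AE t in lebesgue_on {0..}. (vel has_vector_derivative u t - vel t) (at t within {0..})) \<and>
     pos 0 = 0 \<and> vel 0 = axis k v0"

definition reach_pos :: "'n \<Rightarrow> real \<Rightarrow> real \<Rightarrow> (real ^ 'n) set" where
  "reach_pos k v0 t = {pos t |u pos vel. u \<in> admissible \<and> trajectory k v0 u pos vel}"

text \<open>Minima are rendered by \<^const>\<open>Least\<close>, which is the minimum only when it is attained.\<close>

definition dist_reach_pos :: "'n \<Rightarrow> real \<Rightarrow> real \<Rightarrow> real ^ 'n \<Rightarrow> real" where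
  "dist_reach_pos k v0 t h = (LEAST d. d \<in> (\<lambda>h'. norm (h - h')) ` reach_pos k v0 t)"

definition lower_estimator ::
  "real \<Rightarrow> real \<Rightarrow> (real \<Rightarrow> 'a \<Rightarrow> real) \<Rightarrow> real \<Rightarrow> 'a \<Rightarrow> real" where
  "lower_estimator l v \<rho> t h = (LEAST \<theta>. 0 \<le> \<theta> \<and> t \<le> \<theta> \<and> \<rho> \<theta> h = v * (\<theta> - t) + l)"

definition Lambert_W0 :: "real \<Rightarrow> real" where
  "Lambert_W0 = inv_into {-1..} (\<lambda>w. w * exp w)"

end

theory Submission imports Defs
begin

text \<open>
  Starting from rest, the car can reach at time \<open>t\<close> exactly the points of the closed ball of radius
  \<open>R t = t - 1 + exp (- t)\<close> about the origin (\<open>reach_pos_eq_cball\<close>). A constant control \<open>c\<close> leads to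
  \<open>R t *\<^sub>R c\<close>, so every point of the ball is reached. Conversely, fix a final time \<open>T\<close> and follow
  \<open>F s = pos s + (1 - exp (s - T)) *\<^sub>R vel s\<close>, the position the car would have at time \<open>T\<close> if it
  coasted with zero control from time \<open>s\<close> on. Only the control changes this prediction:
  \<open>F' s = (1 - exp (s - T)) *\<^sub>R u s\<close> for almost every \<open>s\<close>. As \<open>F 0 = 0\<close>, \<open>F T = pos T\<close> and
  \<open>norm (u s) \<le> 1\<close>, integration gives \<open>norm (pos T) \<le> R T\<close>.

  The integration needs the fundamental theorem of calculus for an absolutely continuous function
  that is differentiable only almost everywhere. In the gauge integral this is the usual proof for
  everywhere differentiable functions plus one remark: the pieces of a fine division whose tag lies
  in the exceptional null set can be forced into an open set of small measure, and there absolute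
  continuity makes the increments of the function small in total.

  The distance from \<open>h\<close> to the reachable set is therefore \<open>max 0 (norm h - R \<theta>)\<close>. Because
  \<open>norm h - R \<theta> - (v * (\<theta> - t) + l)\<close> is strictly decreasing in \<open>\<theta>\<close> and positive at \<open>\<theta> = t\<close>, it
  has exactly one zero after \<open>t\<close>, and this zero is the estimator. Written out, the zero solves
  \<open>(1 + v) * \<theta> + exp (- \<theta>) = C\<close>, which the Lambert function inverts; the principal branch is the
  right one since \<open>\<theta> \<ge> 0\<close>.
\<close>

section \<open>Absolutely continuous functions\<close>

lemma abs_continuous_onD:
  assumes "abs_continuous_on a b f" "\<epsilon> > 0"
  obtains \<delta> where "\<delta> > 0"
    "\<And>D. \<lbrakk>finite D; \<And>x y. (x, y) \<in> D \<Longrightarrow> a \<le> x \<and> x \<le> y \<and> y \<le> b;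
       disjoint_family_on (\<lambda>(x, y). {x<..<y}) D; (\<Sum>(x, y)\<in>D. y - x) < \<delta>\<rbrakk>
     \<Longrightarrow> (\<Sum>(x, y)\<in>D. norm (f y - f x)) < \<epsilon>"
  using assms unfolding abs_continuous_on_def by (smt (verit) case_prodI2)

text \<open>
  A single criterion from which stability under sums, products with Lipschitz functions, and the
  Lipschitz case itself follow: the increments of \<open>F\<close> are controlled by those of two functions
  already known to be absolutely continuous.
\<close>

lemma abs_continuous_on_dominated:
  fixes f :: "real \<Rightarrow> 'a::real_normed_vector" and g :: "real \<Rightarrow> 'b::real_normed_vector"
    and F :: "real \<Rightarrow> 'c::real_normed_vector"
  assumes f: "abs_continuous_on a b f" and g: "abs_continuous_on a b g"
    and le: "\<And>x y. \<lbrakk>a \<le> x; x \<le> y; y \<le> b\<rbrakk>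
      \<Longrightarrow> norm (F y - F x) \<le> A * norm (f y - f x) + B * norm (g y - g x)"
  shows "abs_continuous_on a b F"
  unfolding abs_continuous_on_def
proof (intro allI impI)
  fix \<epsilon> :: real assume "\<epsilon> > 0"
  define C where "C = \<bar>A\<bar> + \<bar>B\<bar> + 1"
  have C: "C > 0" "A \<le> C" "B \<le> C" by (auto simp: C_def)
  have "\<epsilon> / (2 * C) > 0" using C \<open>\<epsilon> > 0\<close> by simp
  obtain \<delta>1 where \<delta>1: "\<delta>1 > 0"
    "\<And>D. \<lbrakk>finite D; \<And>x y. (x, y) \<in> D \<Longrightarrow> a \<le> x \<and> x \<le> y \<and> y \<le> b;
       disjoint_family_on (\<lambda>(x, y). {x<..<y}) D; (\<Sum>(x, y)\<in>D. y - x) < \<delta>1\<rbrakk>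
     \<Longrightarrow> (\<Sum>(x, y)\<in>D. norm (f y - f x)) < \<epsilon> / (2 * C)"
    using abs_continuous_onD[OF f \<open>\<epsilon> / (2 * C) > 0\<close>] by metis
  obtain \<delta>2 where \<delta>2: "\<delta>2 > 0"
    "\<And>D. \<lbrakk>finite D; \<And>x y. (x, y) \<in> D \<Longrightarrow> a \<le> x \<and> x \<le> y \<and> y \<le> b;
       disjoint_family_on (\<lambda>(x, y). {x<..<y}) D; (\<Sum>(x, y)\<in>D. y - x) < \<delta>2\<rbrakk>
     \<Longrightarrow> (\<Sum>(x, y)\<in>D. norm (g y - g x)) < \<epsilon> / (2 * C)"
    using abs_continuous_onD[OF g \<open>\<epsilon> / (2 * C) > 0\<close>] by metis
  show "\<exists>\<delta>>0. \<forall>D. finite D \<and> (\<forall>(x, y)\<in>D. a \<le> x \<and> x \<le> y \<and> y \<le> b) \<and>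
        disjoint_family_on (\<lambda>(x, y). {x<..<y}) D \<and> (\<Sum>(x, y)\<in>D. y - x) < \<delta>
        \<longrightarrow> (\<Sum>(x, y)\<in>D. norm (F y - F x)) < \<epsilon>"
  proof (intro exI[of _ "min \<delta>1 \<delta>2"] conjI allI impI)
    fix D
    assume D: "finite D \<and> (\<forall>(x, y)\<in>D. a \<le> x \<and> x \<le> y \<and> y \<le> b) \<and>
        disjoint_family_on (\<lambda>(x, y). {x<..<y}) D \<and> (\<Sum>(x, y)\<in>D. y - x) < min \<delta>1 \<delta>2"
    have *: "norm (F y - F x) \<le> C * norm (f y - f x) + C * norm (g y - g x)"
      if "(x, y) \<in> D" for x y
    proof -
      have "norm (F y - F x) \<le> A * norm (f y - f x) + B * norm (g y - g x)"
        using D that by (intro le) auto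
      also have "\<dots> \<le> C * norm (f y - f x) + C * norm (g y - g x)"
        using C by (intro add_mono mult_right_mono) auto
      finally show ?thesis .
    qed
    have "(\<Sum>(x, y)\<in>D. norm (F y - F x))
        \<le> (\<Sum>(x, y)\<in>D. C * norm (f y - f x) + C * norm (g y - g x))"
      by (rule sum_mono) (auto intro: *)
    also have "\<dots> = C * (\<Sum>(x, y)\<in>D. norm (f y - f x)) + C * (\<Sum>(x, y)\<in>D. norm (g y - g x))"
      by (simp add: split_def sum.distrib sum_distrib_left)
    also have "\<dots> < C * (\<epsilon> / (2 * C)) + C * (\<epsilon> / (2 * C))"
      using D C by (intro add_strict_mono mult_strict_left_mono \<delta>1(2) \<delta>2(2)) auto
    also have "\<dots> = \<epsilon>" using C by (simp add: field_simps)
    finally show "(\<Sum>(x, y)\<in>D. norm (F y - F x)) < \<epsilon>" .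
  qed (use \<delta>1 \<delta>2 in auto)
qed

lemma abs_continuous_on_ident: "abs_continuous_on a b (\<lambda>x::real. x)"
  unfolding abs_continuous_on_def
proof (intro allI impI)
  fix \<epsilon> :: real assume "\<epsilon> > 0"
  have "(\<Sum>(x, y)\<in>D. norm (y - x)) = (\<Sum>(x, y)\<in>D. y - x)"
    if "\<forall>(x, y)\<in>D. a \<le> x \<and> x \<le> y \<and> y \<le> b" for D :: "(real \<times> real) set"
    using that by (intro sum.cong) auto
  with \<open>\<epsilon> > 0\<close> show "\<exists>\<delta>>0. \<forall>D. finite D \<and> (\<forall>(x, y)\<in>D. a \<le> x \<and> x \<le> y \<and> y \<le> b) \<and>
        disjoint_family_on (\<lambda>(x, y). {x<..<y}) D \<and> (\<Sum>(x, y)\<in>D. y - x) < \<delta>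
        \<longrightarrow> (\<Sum>(x, y)\<in>D. norm (y - x)) < \<epsilon>"
    by (intro exI[of _ \<epsilon>]) auto
qed

lemma abs_continuous_on_lipschitz:
  assumes "C-lipschitz_on {a..b} f"
  shows "abs_continuous_on a b f"
proof (rule abs_continuous_on_dominated[OF abs_continuous_on_ident abs_continuous_on_ident,
      where A = C and B = 0])
  fix x y assume "a \<le> x" "x \<le> y" "y \<le> b"
  then show "norm (f y - f x) \<le> C * norm (y - x) + 0 * norm (y - x)"
    using lipschitz_onD[OF assms, of y x] by (simp add: dist_norm)
qed

lemma abs_continuous_on_add:
  assumes "abs_continuous_on a b f" "abs_continuous_on a b g"
  shows "abs_continuous_on a b (\<lambda>x. f x + g x)"
  by (rule abs_continuous_on_dominated[OF assms, where A = 1 and B = 1])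
     (auto simp: add_diff_add intro: norm_triangle_ineq)

lemma abs_continuous_on_imp_continuous_on:
  assumes "abs_continuous_on a b f"
  shows "continuous_on {a..b} f"
  unfolding continuous_on_iff
proof (intro ballI allI impI)
  fix x \<epsilon> :: real assume x: "x \<in> {a..b}" and "\<epsilon> > 0"
  obtain \<delta> where \<delta>: "\<delta> > 0"
    "\<And>D. \<lbrakk>finite D; \<And>x y. (x, y) \<in> D \<Longrightarrow> a \<le> x \<and> x \<le> y \<and> y \<le> b;
       disjoint_family_on (\<lambda>(x, y). {x<..<y}) D; (\<Sum>(x, y)\<in>D. y - x) < \<delta>\<rbrakk>
     \<Longrightarrow> (\<Sum>(x, y)\<in>D. norm (f y - f x)) < \<epsilon>"
    using abs_continuous_onD[OF assms \<open>\<epsilon> > 0\<close>] by metis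
  have "dist (f y) (f x) < \<epsilon>" if "y \<in> {a..b}" "dist y x < \<delta>" for y
    using \<delta>(2)[of "{(min x y, max x y)}"] x that
    by (cases "x \<le> y")
       (auto simp: disjoint_family_on_def dist_norm norm_minus_commute min_def max_def
         split: if_splits)
  with \<open>\<delta> > 0\<close> show "\<exists>\<delta>>0. \<forall>y\<in>{a..b}. dist y x < \<delta> \<longrightarrow> dist (f y) (f x) < \<epsilon>" by blast
qed

lemma abs_continuous_on_scaleR_lipschitz:
  assumes g: "abs_continuous_on a b g" and c: "C-lipschitz_on {a..b} c"
  shows "abs_continuous_on a b (\<lambda>x. c x *\<^sub>R g x)"
proof -
  have "compact (c ` {a..b})" "compact (g ` {a..b})"
    using abs_continuous_on_imp_continuous_on[OF g] lipschitz_on_continuous_on[OF c]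
    by (auto intro: compact_continuous_image)
  then have "bounded (c ` {a..b})" "bounded (g ` {a..b})"
    by (auto intro: compact_imp_bounded)
  then obtain A B where A: "\<And>x. x \<in> {a..b} \<Longrightarrow> norm (c x) \<le> A"
      and B: "\<And>x. x \<in> {a..b} \<Longrightarrow> norm (g x) \<le> B"
    unfolding bounded_iff by (metis image_eqI)
  show ?thesis
  proof (rule abs_continuous_on_dominated[OF g abs_continuous_on_ident,
        where A = A and B = "B * C"])
    fix x y assume xy: "a \<le> x" "x \<le> y" "y \<le> b"
    have "c y *\<^sub>R g y - c x *\<^sub>R g x = c y *\<^sub>R (g y - g x) + (c y - c x) *\<^sub>R g x"
      by (simp add: algebra_simps)
    then have "norm (c y *\<^sub>R g y - c x *\<^sub>R g x)
        \<le> \<bar>c y\<bar> * norm (g y - g x) + \<bar>c y - c x\<bar> * norm (g x)"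
      by (metis norm_scaleR norm_triangle_ineq)
    also have "\<dots> \<le> A * norm (g y - g x) + (C * \<bar>y - x\<bar>) * B"
      using A[of y] B[of x] lipschitz_onD[OF c, of y x] lipschitz_on_nonneg[OF c] xy
      by (intro add_mono mult_mono) (auto simp: dist_real_def)
    finally show "norm (c y *\<^sub>R g y - c x *\<^sub>R g x)
        \<le> A * norm (g y - g x) + B * C * norm (y - x)"
      by (simp add: mult_ac)
  qed
qed

section \<open>Recovering an absolutely continuous function from its derivative\<close>

text \<open>
  Cover the null set by an open set whose measure is below the \<open>\<delta>\<close> of absolute continuity.
  Disjoint intervals inside that open set then have total length below \<open>\<delta>\<close>.
\<close>

lemma abs_continuous_on_small_near_negligible:
  assumes f: "abs_continuous_on a b f" and "negligible N" and "\<epsilon> > 0"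
  obtains U where "open U" "N \<subseteq> U"
    "\<And>D. \<lbrakk>finite D; \<And>x y. (x, y) \<in> D \<Longrightarrow> a \<le> x \<and> x \<le> y \<and> y \<le> b;
       disjoint_family_on (\<lambda>(x, y). {x<..<y}) D; \<And>x y. (x, y) \<in> D \<Longrightarrow> {x<..<y} \<subseteq> U\<rbrakk>
     \<Longrightarrow> (\<Sum>(x, y)\<in>D. norm (f y - f x)) < \<epsilon>"
proof -
  obtain \<delta> where \<delta>: "\<delta> > 0"
    "\<And>D. \<lbrakk>finite D; \<And>x y. (x, y) \<in> D \<Longrightarrow> a \<le> x \<and> x \<le> y \<and> y \<le> b;
       disjoint_family_on (\<lambda>(x, y). {x<..<y}) D; (\<Sum>(x, y)\<in>D. y - x) < \<delta>\<rbrakk>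
     \<Longrightarrow> (\<Sum>(x, y)\<in>D. norm (f y - f x)) < \<epsilon>"
    using abs_continuous_onD[OF f \<open>\<epsilon> > 0\<close>] by metis
  have N: "N \<in> lmeasurable" "measure lebesgue N = 0"
    using \<open>negligible N\<close> by (auto simp: negligible_iff_measure)
  obtain U where U: "open U" "N \<subseteq> U" "U - N \<in> lmeasurable"
      "emeasure lebesgue (U - N) < ennreal \<delta>"
    using sets_lebesgue_outer_open[of N \<delta>] N(1) \<open>\<delta> > 0\<close> by (metis fmeasurableD)
  have "N \<union> (U - N) = U" using U(2) by blast
  then have "U \<in> lmeasurable" using fmeasurable.Un[OF N(1) U(3)] by simp
  have "measure lebesgue (U - N) < \<delta>"
    using U(4) \<open>\<delta> > 0\<close> by (simp add: emeasure_eq_measure2[OF U(3)] ennreal_less_iff)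
  then have U_less: "measure lebesgue U < \<delta>"
    using \<open>negligible N\<close> \<open>U \<in> lmeasurable\<close>
    by (simp add: measure_Diff_null_set negligible_iff_null_sets fmeasurableD)
  have "(\<Sum>(x, y)\<in>D. norm (f y - f x)) < \<epsilon>"
    if D: "finite D" "\<And>x y. (x, y) \<in> D \<Longrightarrow> a \<le> x \<and> x \<le> y \<and> y \<le> b"
      "disjoint_family_on (\<lambda>(x, y). {x<..<y}) D" "\<And>x y. (x, y) \<in> D \<Longrightarrow> {x<..<y} \<subseteq> U"
    for D
  proof (rule \<delta>(2)[OF D(1-3)])
    have "(\<Sum>(x, y)\<in>D. y - x) = (\<Sum>p\<in>D. measure lebesgue (case p of (x, y) \<Rightarrow> {x<..<y}))"
      using D(2) by (intro sum.cong) auto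
    also have "\<dots> = measure lebesgue (\<Union>p\<in>D. case p of (x, y) \<Rightarrow> {x<..<y})"
      using D by (intro measure_finite_Union[symmetric]) auto
    also have "\<dots> \<le> measure lebesgue U"
      using D(4) \<open>U \<in> lmeasurable\<close>
      by (intro measure_mono_fmeasurable sets.finite_UN D(1)) auto
    also have "\<dots> < \<delta>" by (rule U_less)
    finally show "(\<Sum>(x, y)\<in>D. y - x) < \<delta>" .
  qed blast
  then show thesis by (rule that[OF U(1,2)])
qed

text \<open>
  Absolute continuity speaks of finite sets of pairs of endpoints, whereas the gauge integral uses
  tagged divisions. The same interval may carry two tags, but only if it is degenerate, so replacing
  tagged intervals by endpoint pairs changes no sum whose terms vanish on degenerate intervals.
\<close>

lemma sum_tagged_partial_division_as_intervals:
  fixes h :: "real \<Rightarrow> real \<Rightarrow> real"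
  assumes q: "q tagged_partial_division_of {a..b}" and h: "\<And>x. h x x = 0"
  obtains D where "finite D" "\<And>x y. (x, y) \<in> D \<Longrightarrow> a \<le> x \<and> x \<le> y \<and> y \<le> b"
    "disjoint_family_on (\<lambda>(x, y). {x<..<y}) D"
    "\<And>x y. (x, y) \<in> D \<Longrightarrow> {x..y} \<in> snd ` q"
    "(\<Sum>(x, K)\<in>q. h (Inf K) (Sup K)) = (\<Sum>(x, y)\<in>D. h x y)"
proof -
  define e where "e K = (Inf K, Sup K)" for K :: "real set"
  define D where "D = e ` snd ` q"
  note qD = tagged_partial_division_ofD[OF q]
  have K: "\<exists>x y. K = {x..y} \<and> a \<le> x \<and> x \<le> y \<and> y \<le> b \<and> e K = (x, y)"
    if K: "K \<in> snd ` q" for K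
  proof -
    obtain z where z: "(z, K) \<in> q" using K by auto
    then obtain x y where xy: "K = {x..y}" using qD(4)[OF z] by auto
    then show ?thesis using qD(2,3)[OF z] by (auto simp: e_def)
  qed
  have inj: "inj_on e (snd ` q)"
    by (rule inj_onI) (metis K prod.inject)
  have mem: "a \<le> x \<and> x \<le> y \<and> y \<le> b \<and> {x..y} \<in> snd ` q \<and> e {x..y} = (x, y)"
    if xy: "(x, y) \<in> D" for x y
  proof -
    obtain K' where "K' \<in> snd ` q" "e K' = (x, y)" using xy unfolding D_def by force
    then show ?thesis using K by (metis prod.inject)
  qed
  have disj: "{x<..<y} \<inter> {x'<..<y'} = {}"
    if xy: "(x, y) \<in> D" "(x', y') \<in> D" "(x, y) \<noteq> (x', y')" for x y x' y'
  proof -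
    obtain z z' where "(z, {x..y}) \<in> q" "(z', {x'..y'}) \<in> q"
      using mem[OF xy(1)] mem[OF xy(2)] by auto
    moreover have "{x..y} \<noteq> {x'..y'}" using mem xy by metis
    ultimately have "interior {x..y} \<inter> interior {x'..y'} = {}"
      by (intro qD(5)[of z _ z']) auto
    then show ?thesis by (simp add: interior_atLeastAtMost_real)
  qed
  \<comment> \<open>The case distinction supplies a value at the empty interval, whose \<open>Inf\<close> and \<open>Sup\<close> are not
    known to agree.\<close>
  have "(\<Sum>(x, K)\<in>q. if K = {} then 0 else h (Inf K) (Sup K))
      = (\<Sum>K\<in>snd ` q. if K = {} then 0 else h (Inf K) (Sup K))"
    by (rule sum.over_tagged_division_lemma[OF tagged_partial_division_of_Union_self[OF q]])
       (auto simp: h order.antisym not_less)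
  moreover have "(\<Sum>(x, K)\<in>q. if K = {} then 0 else h (Inf K) (Sup K))
      = (\<Sum>(x, K)\<in>q. h (Inf K) (Sup K))"
    using qD(2) by (intro sum.cong) (auto dest: qD(2))
  moreover have "(\<Sum>K\<in>snd ` q. if K = {} then 0 else h (Inf K) (Sup K))
      = (\<Sum>K\<in>snd ` q. case e K of (x, y) \<Rightarrow> h x y)"
    using qD(2) by (intro sum.cong) (auto simp: e_def dest: qD(2))
  moreover have "\<dots> = (\<Sum>(x, y)\<in>D. h x y)"
    unfolding D_def by (simp add: sum.reindex[OF inj])
  ultimately have "(\<Sum>(x, K)\<in>q. h (Inf K) (Sup K)) = (\<Sum>(x, y)\<in>D. h x y)" by simp
  moreover have "disjoint_family_on (\<lambda>(x, y). {x<..<y}) D"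
    unfolding disjoint_family_on_def using disj by fast
  ultimately show thesis
    using mem qD(1) by (intro that[of D]) (auto simp: D_def)
qed

text \<open>
  In a sufficiently fine tagged division, a piece with tag outside \<open>N\<close> satisfies the straddle
  estimate of differentiability, with an error proportional to its length. The pieces tagged in \<open>N\<close>
  lie in a small open set and contribute little by absolute continuity, once the integrand has been
  set to \<open>0\<close> on \<open>N\<close>.
\<close>

theorem fundamental_theorem_of_calculus_abs_continuous:
  fixes f :: "real \<Rightarrow> 'a::banach"
  assumes "a \<le> b" and f: "abs_continuous_on a b f" and N: "negligible N"
    and vecd: "\<And>x. x \<in> {a..b} - N \<Longrightarrow> (f has_vector_derivative f' x) (at x within {a..b})"
  shows "(f' has_integral (f b - f a)) {a..b}"
proof -
  define g where "g x = (if x \<in> N then 0 else f' x)" for x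
  have "(g has_integral (f b - f a)) (cbox a b)"
    unfolding has_integral
  proof (intro allI impI)
    fix e :: real assume "e > 0"
    \<comment> \<open>The extra \<open>1\<close> keeps the denominator positive when \<open>a = b\<close>.\<close>
    define \<eta> where "\<eta> = e / (2 * (b - a + 1))"
    have \<eta>: "\<eta> > 0" "\<eta> * (b - a) \<le> e / 2"
      using \<open>e > 0\<close> \<open>a \<le> b\<close> by (auto simp: \<eta>_def field_simps)
    have "\<forall>x. \<exists>d>0. x \<in> {a..b} - N \<longrightarrow>
        (\<forall>y\<in>{a..b}. norm (y-x) < d \<longrightarrow> norm (f y - f x - (y-x) *\<^sub>R f' x) \<le> \<eta> * norm (y-x))"
      using vecd[unfolded has_vector_derivative_def has_derivative_within_alt] \<open>\<eta> > 0\<close>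
      by (meson zero_less_one)
    then obtain d where d: "\<And>x. 0 < d x"
       "\<And>x y. \<lbrakk>x \<in> {a..b} - N; y \<in> {a..b}; norm (y-x) < d x\<rbrakk>
          \<Longrightarrow> norm (f y - f x - (y-x) *\<^sub>R f' x) \<le> \<eta> * norm (y-x)"
      by metis
    obtain U where U: "open U" "N \<subseteq> U"
      "\<And>D. \<lbrakk>finite D; \<And>x y. (x, y) \<in> D \<Longrightarrow> a \<le> x \<and> x \<le> y \<and> y \<le> b;
         disjoint_family_on (\<lambda>(x, y). {x<..<y}) D; \<And>x y. (x, y) \<in> D \<Longrightarrow> {x<..<y} \<subseteq> U\<rbrakk>
       \<Longrightarrow> (\<Sum>(x, y)\<in>D. norm (f y - f x)) < e / 2"
      using abs_continuous_on_small_near_negligible[OF f N half_gt_zero[OF \<open>e > 0\<close>]] by metis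
    define \<gamma> where "\<gamma> x = (if x \<in> N then U else ball x (d x))" for x
    show "\<exists>\<gamma>. gauge \<gamma> \<and> (\<forall>p. p tagged_division_of cbox a b \<and> \<gamma> fine p \<longrightarrow>
        norm ((\<Sum>(x, K)\<in>p. measure lborel K *\<^sub>R g x) - (f b - f a)) < e)"
    proof (intro exI conjI allI impI)
      show "gauge \<gamma>" using U d(1) by (auto simp: gauge_def \<gamma>_def)
      fix p assume "p tagged_division_of cbox a b \<and> \<gamma> fine p"
      then have p: "p tagged_division_of cbox a b" and fine: "\<gamma> fine p" by auto
      note pD = tagged_division_ofD[OF p]
      let ?t = "\<lambda>(x, K). measure lborel K *\<^sub>R g x - (f (Sup K) - f (Inf K))"
      define q where "q = {(x, K) \<in> p. x \<in> N}"
      have q: "q \<subseteq> p" "q tagged_partial_division_of {a..b}"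
        using p tagged_partial_division_subset[of p "{a..b}" q]
        by (auto simp: q_def tagged_division_of_def)
      have ba: "b - a = (\<Sum>(x,K)\<in>p. Sup K - Inf K)"
        "f b - f a = (\<Sum>(x,K)\<in>p. f (Sup K) - f (Inf K))"
        using additive_tagged_division_1[where f= "\<lambda>x. x"] additive_tagged_division_1[where f= f]
          \<open>a \<le> b\<close> p by auto
      have nonneg: "0 \<le> Sup K - Inf K" if "(x, K) \<in> p" for x K
        using pD(2,4)[OF that] by auto
      have bad: "norm (\<Sum>z\<in>q. ?t z) < e / 2"
      proof -
        obtain D where D: "finite D" "\<And>x y. (x, y) \<in> D \<Longrightarrow> a \<le> x \<and> x \<le> y \<and> y \<le> b"
            "disjoint_family_on (\<lambda>(x, y). {x<..<y}) D"
            "\<And>x y. (x, y) \<in> D \<Longrightarrow> {x..y} \<in> snd ` q"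
            "(\<Sum>(x, K)\<in>q. norm (f (Sup K) - f (Inf K))) = (\<Sum>(x, y)\<in>D. norm (f y - f x))"
          using sum_tagged_partial_division_as_intervals[OF q(2),
              of "\<lambda>x y. norm (f y - f x)"] by auto
        have "{x<..<y} \<subseteq> U" if xy: "(x, y) \<in> D" for x y
        proof -
          obtain z where z: "(z, {x..y}) \<in> q" using D(4)[OF xy] by auto
          then have "{x..y} \<subseteq> \<gamma> z" "z \<in> N" using fine by (auto simp: q_def fine_def)
          then show ?thesis by (auto simp: \<gamma>_def)
        qed
        then have "(\<Sum>(x, y)\<in>D. norm (f y - f x)) < e / 2"
          using D by (intro U(3)) auto
        moreover have "norm (\<Sum>z\<in>q. ?t z) \<le> (\<Sum>(x, K)\<in>q. norm (f (Sup K) - f (Inf K)))"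
          by (rule sum_norm_le) (auto simp: q_def g_def norm_minus_commute)
        ultimately show ?thesis using D(5) by simp
      qed
      have "norm (\<Sum>z\<in>p-q. ?t z) \<le> (\<Sum>z\<in>p-q. \<eta> * (case z of (x, K) \<Rightarrow> Sup K - Inf K))"
      proof (rule sum_norm_le, safe)
        fix x K assume xK: "(x, K) \<in> p" "(x, K) \<notin> q"
        then have "x \<notin> N" by (auto simp: q_def)
        obtain u v where k: "K = {u..v}" using pD(4)[OF xK(1)] by auto
        have sub: "x \<in> K" "K \<subseteq> {a..b}" "K \<subseteq> ball x (d x)"
          using pD(2,3)[OF xK(1)] fineD[OF fine xK(1)] \<open>x \<notin> N\<close> by (auto simp: \<gamma>_def)
        have x: "x \<in> {a..b} - N" "u \<le> x" "x \<le> v" using sub \<open>x \<notin> N\<close> k by auto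
        have "u \<in> K" "v \<in> K" using x k by auto
        have "norm ((v - u) *\<^sub>R f' x - (f v - f u))
            = norm (f u - f x - (u - x) *\<^sub>R f' x - (f v - f x - (v - x) *\<^sub>R f' x))"
          by (simp add: algebra_simps)
        also have "\<dots> \<le> norm (f u - f x - (u - x) *\<^sub>R f' x) + norm (f v - f x - (v - x) *\<^sub>R f' x)"
          by (rule norm_triangle_ineq4)
        also have "\<dots> \<le> \<eta> * norm (u - x) + \<eta> * norm (v - x)"
          using sub \<open>u \<in> K\<close> \<open>v \<in> K\<close> x(1)
          by (intro add_mono d(2)) (auto simp: dist_real_def subset_iff)
        also have "\<dots> = \<eta> * (v - u)" using x by (simp add: algebra_simps)
        finally show "norm (measure lborel K *\<^sub>R g x - (f (Sup K) - f (Inf K))) \<le> \<eta> * (Sup K - Inf K)"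
          using x by (simp add: k g_def)
      qed
      also have "\<dots> \<le> (\<Sum>z\<in>p. \<eta> * (case z of (x, K) \<Rightarrow> Sup K - Inf K))"
        using \<eta> nonneg pD(1) by (intro sum_mono2) auto
      also have "\<dots> = \<eta> * (b - a)" by (simp add: ba(1) sum_distrib_left)
      also have "\<dots> \<le> e / 2" by (rule \<eta>)
      finally have good: "norm (\<Sum>z\<in>p-q. ?t z) \<le> e / 2" .
      have "(\<Sum>(x, K)\<in>p. measure lborel K *\<^sub>R g x) - (f b - f a) = (\<Sum>z\<in>p. ?t z)"
        by (simp add: ba(2) split_def sum_subtractf)
      also have "\<dots> = (\<Sum>z\<in>p-q. ?t z) + (\<Sum>z\<in>q. ?t z)"
        using q(1) pD(1) by (rule sum.subset_diff)
      finally show "norm ((\<Sum>(x, K)\<in>p. measure lborel K *\<^sub>R g x) - (f b - f a)) < e"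
        using good bad norm_triangle_ineq[of "\<Sum>z\<in>p-q. ?t z" "\<Sum>z\<in>q. ?t z"] by simp
    qed
  qed
  then show ?thesis
    using has_integral_spike[OF N, of "{a..b}" f' g "f b - f a"] by (auto simp: g_def)
qed

section \<open>The reachable set from rest\<close>

definition reach_radius :: "real \<Rightarrow> real" where
  "reach_radius t = t - 1 + exp (- t)"

lemma reach_radius_strict_mono:
  assumes "0 \<le> s" "s < t"
  shows "reach_radius s < reach_radius t"
proof (rule DERIV_pos_imp_increasing_open[OF assms(2)])
  fix x assume "s < x" "x < t"
  then show "\<exists>y. (reach_radius has_real_derivative y) (at x) \<and> 0 < y"
    using assms unfolding reach_radius_def
    by (intro exI[of _ "1 - exp (- x)"]) (auto intro!: derivative_eq_intros)
qed (auto simp: reach_radius_def intro!: continuous_intros)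

lemma reach_radius_nonneg: "reach_radius t \<ge> 0"
  using exp_ge_add_one_self[of "- t"] by (simp add: reach_radius_def)

lemma AE_lebesgue_on_negligible:
  assumes "AE x in lebesgue_on S. P x" "S \<in> sets lebesgue"
  shows "negligible {x \<in> S. \<not> P x}"
proof -
  have "AE x in lebesgue. x \<in> S \<longrightarrow> P x"
    using assms by (subst (asm) AE_restrict_space_iff) auto
  then show ?thesis
    by (simp add: completion.AE_iff_null_sets negligible_iff_null_sets)
qed

text \<open>
  \<open>F s\<close> is the position predicted for time \<open>T\<close> under coasting from the state at time \<open>s\<close>; coasting
  for a time \<open>T - s\<close> covers \<open>1 - exp (s - T)\<close> times the current velocity. In the derivative of \<open>F\<close>
  all terms in the velocity cancel, which leaves the control alone, weighted by that factor. The
  integral of the weight is \<open>reach_radius T\<close>.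
\<close>

lemma trajectory_pos_bound:
  assumes u: "u \<in> admissible" and tr: "trajectory k 0 u pos vel" and "T \<ge> 0"
  shows "norm (pos T) \<le> reach_radius T"
proof -
  define c where "c s = 1 - exp (s - T)" for s
  define F where "F s = pos s + c s *\<^sub>R vel s" for s
  define N where "N = {s \<in> {0..}. \<not> (pos has_vector_derivative vel s) (at s within {0..})} \<union>
     {s \<in> {0..}. \<not> (vel has_vector_derivative u s - vel s) (at s within {0..})}"
  have N: "negligible N"
    using tr unfolding N_def trajectory_def
    by (intro negligible_Un AE_lebesgue_on_negligible) auto
  have c_lip: "1-lipschitz_on {0..T} c"
  proof (rule bounded_derivative_imp_lipschitz)
    show "(c has_derivative (\<lambda>h. h *\<^sub>R - exp (s - T))) (at s within {0..T})" for s
      unfolding c_def by (auto intro!: derivative_eq_intros simp: fun_eq_iff)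
    show "onorm (\<lambda>h. h *\<^sub>R - exp (s - T)) \<le> 1" if "s \<in> {0..T}" for s
      using that by (intro onorm_bound) (auto simp: abs_mult mult_left_le)
  qed auto
  have "abs_continuous_on 0 T F"
    unfolding F_def using tr \<open>T \<ge> 0\<close> c_lip
    by (intro abs_continuous_on_add abs_continuous_on_scaleR_lipschitz)
       (auto simp: trajectory_def)
  moreover have "(F has_vector_derivative c s *\<^sub>R u s) (at s within {0..T})"
    if s: "s \<in> {0..T} - N" for s
  proof -
    have "(pos has_vector_derivative vel s) (at s within {0..T})"
      "(vel has_vector_derivative u s - vel s) (at s within {0..T})"
      using s by (auto simp: N_def intro: has_vector_derivative_within_subset[of _ _ _ "{0..}"])
    moreover have "(c has_real_derivative - exp (s - T)) (at s within {0..T})"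
      unfolding c_def by (auto intro!: derivative_eq_intros)
    ultimately have "(F has_vector_derivative vel s + (c s *\<^sub>R (u s - vel s) + (- exp (s - T)) *\<^sub>R vel s))
        (at s within {0..T})"
      unfolding F_def
      by (intro has_vector_derivative_add has_vector_derivative_scaleR)
    moreover have "vel s + (c s *\<^sub>R (u s - vel s) + (- exp (s - T)) *\<^sub>R vel s) = c s *\<^sub>R u s"
      by (simp add: c_def algebra_simps)
    ultimately show ?thesis by simp
  qed
  ultimately have F: "((\<lambda>s. c s *\<^sub>R u s) has_integral (F T - F 0)) {0..T}"
    by (intro fundamental_theorem_of_calculus_abs_continuous[OF \<open>T \<ge> 0\<close> _ N])
  have C: "(c has_integral (T - exp (T - T)) - (0 - exp (0 - T))) {0..T}"
    using \<open>T \<ge> 0\<close> unfolding c_def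
    by (intro fundamental_theorem_of_calculus)
       (auto intro!: derivative_eq_intros simp flip: has_real_derivative_iff_has_vector_derivative)
  have "norm (integral {0..T} (\<lambda>s. c s *\<^sub>R u s)) \<le> integral {0..T} c"
  proof (rule integral_norm_bound_integral)
    fix s assume s: "s \<in> {0..T}"
    then have "norm (u s) \<le> 1" "0 \<le> c s" using u by (auto simp: admissible_def c_def)
    then show "norm (c s *\<^sub>R u s) \<le> c s" by (simp add: mult_left_le)
  qed (use F C in \<open>auto simp: integrable_on_def\<close>)
  moreover have "F T - F 0 = pos T"
    using tr by (simp add: F_def c_def trajectory_def)
  ultimately show ?thesis
    using integral_unique[OF F] integral_unique[OF C] by (simp add: reach_radius_def)
qed

lemma trajectory_const:
  assumes "norm c \<le> 1"
  shows "trajectory k 0 (\<lambda>_. c) (\<lambda>s. reach_radius s *\<^sub>R c) (\<lambda>s. (1 - exp (- s)) *\<^sub>R c)"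
proof -
  have pos: "((\<lambda>s. reach_radius s *\<^sub>R c) has_vector_derivative (1 - exp (- s)) *\<^sub>R c) (at s within S)"
    for s S unfolding reach_radius_def
    by (auto intro!: derivative_eq_intros simp: has_vector_derivative_def fun_eq_iff algebra_simps)
  have vel: "((\<lambda>s. (1 - exp (- s)) *\<^sub>R c) has_vector_derivative c - (1 - exp (- s)) *\<^sub>R c)
      (at s within S)" for s S
    by (auto intro!: derivative_eq_intros simp: has_vector_derivative_def fun_eq_iff algebra_simps)
  have ac: "abs_continuous_on 0 T f"
    if f: "\<And>s. s \<in> {0..T} \<Longrightarrow> (f has_vector_derivative e s *\<^sub>R c) (at s within {0..T})"
      "\<And>s. s \<in> {0..T} \<Longrightarrow> \<bar>e s\<bar> \<le> 1" for f e T
  proof (rule abs_continuous_on_lipschitz[where C = 1], rule bounded_derivative_imp_lipschitz)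
    show "(f has_derivative (\<lambda>h. h *\<^sub>R e s *\<^sub>R c)) (at s within {0..T})" if "s \<in> {0..T}" for s
      using f(1)[OF that] by (simp add: has_vector_derivative_def)
    show "onorm (\<lambda>h. h *\<^sub>R e s *\<^sub>R c) \<le> 1" if "s \<in> {0..T}" for s
    proof (rule onorm_bound)
      fix h :: real
      have "\<bar>e s\<bar> * norm c \<le> 1" using f(2)[OF that] assms by (simp add: mult_le_one)
      then show "norm (h *\<^sub>R e s *\<^sub>R c) \<le> 1 * norm h"
        using mult_left_le[of "\<bar>e s\<bar> * norm c" "\<bar>h\<bar>"] by (simp add: abs_mult mult.assoc)
    qed simp
  qed auto
  have "abs_continuous_on 0 T (\<lambda>s. reach_radius s *\<^sub>R c)" for T
    by (rule ac[where e = "\<lambda>s. 1 - exp (- s)"]) (auto intro: pos)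
  moreover have "abs_continuous_on 0 T (\<lambda>s. (1 - exp (- s)) *\<^sub>R c)" for T
  proof (rule ac[where e = "\<lambda>s. exp (- s)"])
    show "((\<lambda>s. (1 - exp (- s)) *\<^sub>R c) has_vector_derivative exp (- s) *\<^sub>R c)
      (at s within {0..T})" for s
      using vel[of s "{0..T}"] by (simp add: algebra_simps)
  qed auto
  ultimately show ?thesis
    using pos vel by (simp add: trajectory_def reach_radius_def)
qed

theorem reach_pos_eq_cball:
  fixes k :: "'n::finite"
  assumes "t \<ge> 0"
  shows "reach_pos k 0 t = cball 0 (reach_radius t)"
proof (intro equalityI subsetI)
  fix x assume "x \<in> reach_pos k 0 t"
  then show "x \<in> cball 0 (reach_radius t)"
    using trajectory_pos_bound assms by (auto simp: reach_pos_def)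
next
  fix x :: "real ^ 'n" assume x: "x \<in> cball 0 (reach_radius t)"
  define c where "c = inverse (reach_radius t) *\<^sub>R x"
  have c: "norm c \<le> 1" "x = reach_radius t *\<^sub>R c"
    using x reach_radius_nonneg[of t]
    by (cases "reach_radius t = 0"; auto simp: c_def field_simps)+
  have "(\<lambda>_. c) \<in> admissible" using c by (simp add: admissible_def)
  with trajectory_const[OF c(1)] c(2) show "x \<in> reach_pos k 0 t"
    unfolding reach_pos_def by (metis (mono_tags, lifting) mem_Collect_eq)
qed

lemma dist_reach_pos_eq:
  assumes "t \<ge> 0"
  shows "dist_reach_pos k 0 t h = max 0 (norm h - reach_radius t)"
  unfolding dist_reach_pos_def reach_pos_eq_cball[OF assms]
proof (rule Least_equality)
  show "max 0 (norm h - reach_radius t) \<in> (\<lambda>h'. norm (h - h')) ` cball 0 (reach_radius t)"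
  proof (cases "norm h \<le> reach_radius t")
    case True
    then show ?thesis by (intro image_eqI[of _ _ h]) auto
  next
    case False
    let ?r = "reach_radius t / norm h"
    have h: "norm h > 0" and r: "0 \<le> ?r" "?r \<le> 1"
      using False reach_radius_nonneg[of t] by (auto simp: divide_le_eq_1)
    have "h - ?r *\<^sub>R h = (1 - ?r) *\<^sub>R h" by (simp add: algebra_simps)
    then have "norm (h - ?r *\<^sub>R h) = (1 - ?r) * norm h" using r by simp
    also have "\<dots> = norm h - reach_radius t" using h by (simp add: field_simps)
    finally show ?thesis
      using False h reach_radius_nonneg[of t] by (intro image_eqI[of _ _ "?r *\<^sub>R h"]) auto
  qed
  fix d assume "d \<in> (\<lambda>h'. norm (h - h')) ` cball 0 (reach_radius t)"
  then obtain h' where "d = norm (h - h')" "norm h' \<le> reach_radius t" by auto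
  then show "max 0 (norm h - reach_radius t) \<le> d"
    using norm_triangle_ineq2[of h h'] by simp
qed

section \<open>The estimator\<close>

lemma Lambert_W0_eq:
  assumes "w \<ge> -1" "w * exp w = y"
  shows "Lambert_W0 y = w"
proof -
  have "strict_mono_on {-1..} (\<lambda>w::real. w * exp w)"
  proof (rule strict_mono_onI)
    fix r s :: real assume rs: "r \<in> {-1..}" "s \<in> {-1..}" "r < s"
    show "r * exp r < s * exp s"
    proof (rule DERIV_pos_imp_increasing_open[OF rs(3)])
      fix x assume "r < x" "x < s"
      then have "0 < (1 + x) * exp x" using rs by simp
      then show "\<exists>y. ((\<lambda>w. w * exp w) has_real_derivative y) (at x) \<and> 0 < y"
        by (intro exI[of _ "(1 + x) * exp x"])
          (auto intro!: derivative_eq_intros simp: algebra_simps)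
    qed (auto intro!: continuous_intros)
  qed
  then show ?thesis
    unfolding Lambert_W0_def assms(2)[symmetric]
    by (intro inv_into_f_f strict_mono_on_imp_inj_on) (use assms in auto)
qed

text \<open>
  The exponential moves the root by \<open>w = - exp (- \<theta>) / (1 + v)\<close> from the root \<open>C / (1 + v)\<close> of the
  linear part. Substituting \<open>\<theta> = C / (1 + v) + w\<close> in this expression gives
  \<open>w * exp w = - exp (- C / (1 + v)) / (1 + v)\<close>, and \<open>\<theta> \<ge> 0\<close> gives \<open>w \<ge> -1\<close>, the range of the
  principal branch.
\<close>

lemma linear_plus_exp_root:
  assumes v: "v \<ge> (0::real)" and "\<theta> \<ge> 0" and eq: "(1 + v) * \<theta> + exp (- \<theta>) = C"
  shows "\<theta> = C / (1 + v) + Lambert_W0 (- (exp (- (C / (1 + v))) / (1 + v)))"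
proof -
  define w where "w = - (exp (- \<theta>) / (1 + v))"
  have "C + - exp (- \<theta>) = (1 + v) * \<theta>" using eq by simp
  then have "(C + - exp (- \<theta>)) / (1 + v) = \<theta>" using v by simp
  then have \<theta>: "\<theta> = C / (1 + v) + w" by (simp add: w_def diff_divide_distrib)
  have "exp (- \<theta>) \<le> 1 + v" using \<open>\<theta> \<ge> 0\<close> v by (smt (verit) exp_le_one_iff)
  then have "w \<ge> -1" using v by (simp add: w_def field_simps)
  moreover have "w * exp w = - (exp (- (C / (1 + v))) / (1 + v))"
  proof -
    have "w * exp w = - (exp (- \<theta> + w) / (1 + v))"
      unfolding exp_add by (simp add: w_def)
    also have "- \<theta> + w = - (C / (1 + v))" using \<theta> by simp
    finally show ?thesis .
  qed
  ultimately have "Lambert_W0 (- (exp (- (C / (1 + v))) / (1 + v))) = w" by (rule Lambert_W0_eq)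
  with \<theta> show ?thesis by simp
qed

theorem theorem5:
  fixes k :: "'n::finite" and v0 l v t :: real and h :: "real ^ 'n"
  assumes "v0 = 0" and "l \<ge> 0" and "v \<ge> 0" and "t \<ge> 0"
    and "dist_reach_pos k v0 t h > l"
  shows "lower_estimator l v (dist_reach_pos k v0) t h =
    t + (norm h + 1 - l - t) / (1 + v) +
    Lambert_W0 (- (exp (- ((1 + v * t - l + norm h) / (1 + v))) / (1 + v)))"
proof -
  define g where "g \<theta> = norm h - reach_radius \<theta> - (v * (\<theta> - t) + l)" for \<theta>
  have g_less: "g \<theta>' < g \<theta>" if "t \<le> \<theta>" "\<theta> < \<theta>'" for \<theta> \<theta>'
    using reach_radius_strict_mono[of \<theta> \<theta>'] mult_left_mono[of \<theta> \<theta>' v] that assms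
    by (simp add: g_def algebra_simps)
  have g_t: "g t > 0"
    using assms dist_reach_pos_eq[of t k h] by (simp add: g_def max_def split: if_splits)
  \<comment> \<open>The ball has reached \<open>h\<close> by time \<open>norm h + 1\<close>, since \<open>reach_radius s > s - 1\<close>; hence
    \<open>t + norm h + 1\<close> is late enough for a sign change.\<close>
  have "0 \<le> v * (norm h + 1) + t + l" using assms by simp
  moreover have "g (t + norm h + 1) = - (v * (norm h + 1) + t + l) - exp (- (t + norm h + 1))"
    by (simp add: g_def reach_radius_def algebra_simps)
  ultimately have "g (t + norm h + 1) \<le> 0"
    using exp_gt_zero[of "- (t + norm h + 1)"] by linarith
  moreover have "continuous_on {t..t + norm h + 1} g"
    unfolding g_def reach_radius_def by (intro continuous_intros)
  ultimately obtain \<theta> where \<theta>: "t \<le> \<theta>" "g \<theta> = 0"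
    using IVT2'[of g "t + norm h + 1" 0 t] g_t by auto
  have "lower_estimator l v (dist_reach_pos k v0) t h = \<theta>"
    unfolding lower_estimator_def
  proof (rule Least_equality)
    \<comment> \<open>At the zero of \<open>g\<close> the difference \<open>norm h - reach_radius \<theta>\<close> is nonnegative, so the distance
      is not truncated there.\<close>
    have "0 \<le> v * (\<theta> - t) + l" using assms \<theta> by simp
    then show "0 \<le> \<theta> \<and> t \<le> \<theta> \<and> dist_reach_pos k v0 \<theta> h = v * (\<theta> - t) + l"
      using \<theta> assms by (simp add: dist_reach_pos_eq g_def)
  next
    fix \<theta>' assume \<theta>': "0 \<le> \<theta>' \<and> t \<le> \<theta>' \<and> dist_reach_pos k v0 \<theta>' h = v * (\<theta>' - t) + l"
    then have "norm h - reach_radius \<theta>' \<le> v * (\<theta>' - t) + l"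
      using assms(1) dist_reach_pos_eq[of \<theta>' k h] by simp
    then have "g \<theta>' \<le> 0" by (simp add: g_def)
    then show "\<theta> \<le> \<theta>'" using g_less[of \<theta>' \<theta>] \<theta> \<theta>' by force
  qed
  moreover have "\<theta> = (1 + v * t - l + norm h) / (1 + v) +
      Lambert_W0 (- (exp (- ((1 + v * t - l + norm h) / (1 + v))) / (1 + v)))"
    using \<theta> assms
    by (intro linear_plus_exp_root) (auto simp: g_def reach_radius_def algebra_simps)
  moreover have "(1 + v * t - l + norm h) / (1 + v) = t + (norm h + 1 - l - t) / (1 + v)"
    using assms by (simp add: field_simps)
  ultimately show ?thesis by simp
qed

end
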